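(* Let $K>0$, $q\neq 0$, $p_e\in\mathbb{R}$, $r_e>0$, and let $\Delta=r_e/N$ for some integer $N\ge 1$. Let $p_{an}:[0,r_e]\to\mathbb{R}$ be the solution of the one-dimensional steady-state problem $$\frac{d}{dx}\left(K\frac{d p_{an}}{dx}\right)=0 \ \text{ on } (0,r_e),\qquad p_{an}(r_e)=p_e,\qquad -K\frac{d p_{an}}{dx}\Big|_{x=0}=q .$$ Then a number $R_0\in[0,r_e]$ satisfies the steady-state material balance equation $$-2K\left(p_{an}(\Delta)-p_{an}(R_0)\right)=q\,\Delta$$ if and only if $$R_0=\frac{\Delta}{2}.$$
   Context: The interval $(0,r_e)$ is split by the grid $[0,\Delta,2\Delta,\dots,N\Delta]$ with $N\Delta=r_e$. The one-dimensional steady-state material balance for the block values $p_0$ (block containing the source) and $p_1$ (neighbouring block) is $2K(p_0-p_1)=q\Delta$. The Peaceman problem is called well posed with respect to this material balance if for any given $\Delta$ there is $R_0$ depending on $\Delta$ such that the analytical solution $p_{an}$ satisfies the material balance with $p_0=p_{an}(R_0)$ and $p_1=p_{an}(\Delta)$. $K$ is the constant conductivity and $q$ is the constant rate at $x=0$. *)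

theory Defs
  imports "HOL-Analysis.Derivative"
begin

text \<open>
  Classical solutions of the one-dimensional steady-state problem with constant conductivity:
  the differential equation holds on the open interval, the solution is continuous up to both end
  points, and the derivative in the flux condition is the one-sided derivative at \<open>0\<close>.
\<close>

definition steady_state_solution ::
    "real \<Rightarrow> real \<Rightarrow> real \<Rightarrow> real \<Rightarrow> (real \<Rightarrow> real) \<Rightarrow> bool" where
  "steady_state_solution K q p\<^sub>e r\<^sub>e p \<longleftrightarrow>
     continuous_on {0..r\<^sub>e} p \<and>
     (\<forall>x\<in>{0<..<r\<^sub>e}. p differentiable (at x)) \<and>
     (\<forall>x\<in>{0<..<r\<^sub>e}. ((\<lambda>y. K * deriv p y) has_real_derivative 0) (at x)) \<and>
     p r\<^sub>e = p\<^sub>e \<and>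
     (\<exists>d. (p has_real_derivative d) (at 0 within {0..r\<^sub>e}) \<and> - K * d = q)"

lemma steady_state_solution_exists:
  assumes "K > 0"
  shows "steady_state_solution K q p\<^sub>e r\<^sub>e (\<lambda>x. p\<^sub>e + q / K * (r\<^sub>e - x))"
proof -
  let ?p = "\<lambda>x. p\<^sub>e + q / K * (r\<^sub>e - x)"
  have D: "(?p has_real_derivative - (q / K)) (at x within S)" for x S
    using assms by (auto intro!: derivative_eq_intros)
  have "deriv ?p = (\<lambda>x. - (q / K))"
    using D by (intro ext DERIV_imp_deriv)
  moreover have "?p differentiable (at x)" for x
    using D real_differentiable_def by blast
  moreover have "continuous_on {0..r\<^sub>e} ?p"
    using D by (rule DERIV_continuous_on)
  moreover have "\<exists>d. (?p has_real_derivative d) (at 0 within {0..r\<^sub>e}) \<and> - K * d = q"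
    using assms by (intro exI[of _ "- (q / K)"] conjI D) simp
  ultimately show ?thesis
    unfolding steady_state_solution_def by simp
qed

end

theory Submission
  imports Defs
begin

text \<open>
  The flux \<open>K * p'\<close> has zero derivative, so \<open>p\<close> is affine on the closed interval, and the
  inflow condition fixes its slope to be \<open>- q / K\<close>
  (lemma \<open>steady_state_solution_affine\<close>). A pressure difference is therefore proportional to the
  distance between the two points, and the material balance reduces to
  \<open>2 * q * (\<Delta> - R\<^sub>0) = q * \<Delta>\<close>; since \<open>q \<noteq> 0\<close>, this holds exactly at the midpoint of the
  first block.
\<close>

text \<open>
  By the mean value theorem \<open>f'\<close> is a constant \<open>c\<close> on the open interval, and then so is
  \<open>f x - c * x\<close>; continuity carries the formula to the end points, where \<open>f\<close> may a priori fail to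
  be differentiable.
\<close>

lemma affine_if_deriv_has_zero_derivative:
  fixes f :: "real \<Rightarrow> real"
  assumes "a < b" and cont: "continuous_on {a..b} f"
    and diff: "\<And>x. x \<in> {a<..<b} \<Longrightarrow> f differentiable (at x)"
    and zero: "\<And>x. x \<in> {a<..<b} \<Longrightarrow> (deriv f has_real_derivative 0) (at x)"
  obtains c where "\<And>x. x \<in> {a..b} \<Longrightarrow> f x = f a + c * (x - a)"
proof -
  define c where "c = deriv f ((a + b) / 2)"
  have deriv_const: "deriv f x = c" if "x \<in> {a<..<b}" for x
    unfolding c_def
    using that \<open>a < b\<close> by (intro DERIV_isconst3[of a b]) (auto intro: zero)
  have f_deriv: "(f has_real_derivative c) (at x)" if "x \<in> {a<..<b}" for x
    using diff[OF that] deriv_const[OF that] by (metis DERIV_imp_deriv real_differentiable_def)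
  have "f x - c * x = f a - c * a" if "x \<in> {a..b}" for x
  proof (rule DERIV_isconst2[OF \<open>a < b\<close>])
    show "continuous_on {a..b} (\<lambda>x. f x - c * x)"
      by (intro continuous_intros cont)
    show "((\<lambda>x. f x - c * x) has_real_derivative 0) (at y)" if "a < y" "y < b" for y
      using f_deriv[of y] that by (auto intro!: derivative_eq_intros)
  qed (use that in auto)
  then have "f x = f a + c * (x - a)" if "x \<in> {a..b}" for x
    using that by (fastforce simp: algebra_simps)
  then show thesis by (rule that)
qed

lemma steady_state_solution_affine:
  assumes "K > 0" and "r\<^sub>e > 0" and sol: "steady_state_solution K q p\<^sub>e r\<^sub>e p"
    and "x \<in> {0..r\<^sub>e}"
  shows "p x = p 0 - q / K * x"
proof -
  have zero: "(deriv p has_real_derivative 0) (at y)" if "y \<in> {0<..<r\<^sub>e}" for y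
  proof -
    have "((\<lambda>y. K * deriv p y) has_real_derivative 0) (at y)"
      using sol that by (simp add: steady_state_solution_def)
    from DERIV_cmult[OF this, of "1 / K"] show ?thesis
      using \<open>K > 0\<close> by simp
  qed
  obtain c where c: "\<And>y. y \<in> {0..r\<^sub>e} \<Longrightarrow> p y = p 0 + c * (y - 0)"
    using affine_if_deriv_has_zero_derivative[OF \<open>r\<^sub>e > 0\<close>, of p] sol zero
    by (auto simp: steady_state_solution_def)
  obtain d where d: "(p has_real_derivative d) (at 0 within {0..r\<^sub>e})" and "- K * d = q"
    using sol by (auto simp: steady_state_solution_def)
  have "((\<lambda>y. p 0 + c * (y - 0)) has_real_derivative c) (at 0 within {0..r\<^sub>e})"
    by (auto intro!: derivative_eq_intros)
  then have "(p has_real_derivative c) (at 0 within {0..r\<^sub>e})"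
    by (rule has_field_derivative_transform_within[where d = 1])
      (use \<open>r\<^sub>e > 0\<close> in \<open>auto intro: c[symmetric, simplified]\<close>)
  \<comment> \<open>The one-sided derivative is unique because \<open>0\<close> is a limit point of the interval.\<close>
  then have "c = d"
    using d \<open>r\<^sub>e > 0\<close> vector_derivative_unique_within_closed_interval[of 0 r\<^sub>e 0 p c d]
    by (simp add: has_real_derivative_iff_has_vector_derivative)
  moreover have "d = - (q / K)"
    using \<open>K > 0\<close> by (simp flip: \<open>- K * d = q\<close>)
  ultimately show ?thesis
    by (subst c[OF \<open>x \<in> {0..r\<^sub>e}\<close>]) simp
qed

theorem theorem1:
  fixes K q p\<^sub>e r\<^sub>e \<Delta> R\<^sub>0 :: real and N :: nat and p\<^sub>a\<^sub>n :: "real \<Rightarrow> real"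
  assumes "K > 0" and "q \<noteq> 0" and "r\<^sub>e > 0" and "N \<ge> 1" and "\<Delta> = r\<^sub>e / real N"
    and "steady_state_solution K q p\<^sub>e r\<^sub>e p\<^sub>a\<^sub>n"
    and "R\<^sub>0 \<in> {0..r\<^sub>e}"
  shows "- 2 * K * (p\<^sub>a\<^sub>n \<Delta> - p\<^sub>a\<^sub>n R\<^sub>0) = q * \<Delta> \<longleftrightarrow> R\<^sub>0 = \<Delta> / 2"
proof -
  note affine = steady_state_solution_affine[OF assms(1,3,6)]
  have "r\<^sub>e * 1 \<le> r\<^sub>e * real N"
    using assms(3,4) by (intro mult_left_mono) auto
  then have "\<Delta> \<in> {0..r\<^sub>e}"
    using assms(3-5) by (simp add: divide_le_eq)
  then have "p\<^sub>a\<^sub>n \<Delta> - p\<^sub>a\<^sub>n R\<^sub>0 = - (q / K) * (\<Delta> - R\<^sub>0)"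
    using affine[of \<Delta>] affine[OF assms(7)] by (simp add: right_diff_distrib)
  then have "- 2 * K * (p\<^sub>a\<^sub>n \<Delta> - p\<^sub>a\<^sub>n R\<^sub>0) = q * (2 * (\<Delta> - R\<^sub>0))"
    using assms(1) by simp
  then have "- 2 * K * (p\<^sub>a\<^sub>n \<Delta> - p\<^sub>a\<^sub>n R\<^sub>0) = q * \<Delta> \<longleftrightarrow> 2 * (\<Delta> - R\<^sub>0) = \<Delta>"
    using assms(2) by simp
  also have "\<dots> \<longleftrightarrow> R\<^sub>0 = \<Delta> / 2"
    by argo
  finally show ?thesis .
qed

end
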